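(* Let $t_0>0$, $\alpha>0$, $\delta>0$, $\alpha\delta>1$, $\sigma\ge0$, $\mu>0$, and $\beta(t)=\mu e^{t/\delta}$. Let $\epsilon:[t_0,+\infty)\to\mathcal H_1$ satisfy $\int_{t_0}^{+\infty}\|\epsilon(t)\|\,dt<+\infty$. Let $(x(t),\lambda(t))$ be a global solution on $[t_0,+\infty)$ of $$\begin{cases}\ddot x(t)+\alpha\dot x(t)=-\beta(t)\big(\nabla f(x(t))+A^T(\lambda(t)+\delta\dot\lambda(t))+\sigma A^T(Ax(t)-b)\big)+\epsilon(t),\\ \ddot\lambda(t)+\alpha\dot\lambda(t)=\beta(t)\big(A(x(t)+\delta\dot x(t))-b\big),\end{cases}$$ and let $(x^*,\lambda^* )\in\Omega$. Then $$|f(x(t))-f(x^* )|=\mathcal O\Big(\frac1{e^{t/\delta}}\Big),\qquad \|Ax(t)-b\|=\mathcal O\Big(\frac1{e^{t/\delta}}\Big).$$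
   Context: $\mathcal H_1,\mathcal H_2$ are real Hilbert spaces, $A:\mathcal H_1\to\mathcal H_2$ is a continuous linear operator with adjoint $A^T$, $b\in\mathcal H_2$, and $f:\mathcal H_1\to\mathbb R$ is convex and continuously differentiable. $\Omega\subset\mathcal H_1\times\mathcal H_2$ is the set of saddle points of the Lagrangian $\mathcal L(x,\lambda)=f(x)+\langle\lambda,Ax-b\rangle$, equivalently the set of pairs $(x^*,\lambda^* )$ with $\nabla f(x^* )=-A^T\lambda^*$ and $Ax^*=b$; it is assumed nonempty. A global solution of the system is a pair $(x,\lambda)$ with $x\in\mathcal C^2([t_0,+\infty),\mathcal H_1)$, $\lambda\in\mathcal C^2([t_0,+\infty),\mathcal H_2)$, such that $(x,\lambda)$ and $(\dot x,\dot\lambda)$ are locally absolutely continuous and the system holds for almost every $t\ge t_0$. All $\mathcal O(\cdot)$ are as $t\to+\infty$. *)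

theory Defs
  imports "HOL-Analysis.Analysis" "HOL-Library.Landau_Symbols"
begin

definition gradient :: "('a::real_inner \<Rightarrow> real) \<Rightarrow> 'a \<Rightarrow> 'a"
  where "gradient f x = (THE g. GDERIV f x :> g)"

text \<open>On a real Hilbert space every differentiable real function has a gradient (Riesz), and
  continuity of the Frechet derivative in operator norm is continuity of the gradient.\<close>

definition continuously_differentiable :: "('a::{real_inner,banach} \<Rightarrow> real) \<Rightarrow> bool"
  where "continuously_differentiable f \<longleftrightarrow>
    (\<forall>x. f differentiable (at x)) \<and> continuous_on UNIV (gradient f)"

definition lagrangian ::
    "('a::real_inner \<Rightarrow> real) \<Rightarrow> ('a \<Rightarrow> 'b::real_inner) \<Rightarrow> 'b \<Rightarrow> 'a \<Rightarrow> 'b \<Rightarrow> real"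
  where "lagrangian f A b x l = f x + l \<bullet> (A x - b)"

definition saddle_points ::
    "('a::real_inner \<Rightarrow> real) \<Rightarrow> ('a \<Rightarrow> 'b::real_inner) \<Rightarrow> 'b \<Rightarrow> ('a \<times> 'b) set"
  where "saddle_points f A b = {(xs, ls). \<forall>x l.
    lagrangian f A b xs l \<le> lagrangian f A b xs ls \<and>
    lagrangian f A b xs ls \<le> lagrangian f A b x ls}"

text \<open>Derivatives are taken within \<open>{t0..}\<close>, hence one-sided at \<open>t0\<close>; the values of the curves to
  the left of \<open>t0\<close> are irrelevant.\<close>

definition C2_from ::
    "real \<Rightarrow> (real \<Rightarrow> 'a::real_normed_vector) \<Rightarrow> (real \<Rightarrow> 'a) \<Rightarrow> (real \<Rightarrow> 'a) \<Rightarrow> bool"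
  where "C2_from t0 x x' x'' \<longleftrightarrow>
    (\<forall>t\<ge>t0. (x has_vector_derivative x' t) (at t within {t0..})) \<and>
    (\<forall>t\<ge>t0. (x' has_vector_derivative x'' t) (at t within {t0..})) \<and>
    continuous_on {t0..} x''"

text \<open>A pair \<open>(u, v)\<close> in \<open>I\<close> encodes a subinterval of \<open>[a, b]\<close> with endpoints \<open>u\<close> and \<open>v\<close>.\<close>

definition abs_continuous_on_interval ::
    "real \<Rightarrow> real \<Rightarrow> (real \<Rightarrow> 'a::real_normed_vector) \<Rightarrow> bool"
  where "abs_continuous_on_interval a b g \<longleftrightarrow>
    (\<forall>e>0. \<exists>d>0. \<forall>I. finite I \<and> (\<forall>(u, v)\<in>I. a \<le> u \<and> u \<le> v \<and> v \<le> b) \<and>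
        pairwise (\<lambda>p q. {fst p<..<snd p} \<inter> {fst q<..<snd q} = {}) I \<and>
        (\<Sum>(u, v)\<in>I. v - u) < d
      \<longrightarrow> (\<Sum>(u, v)\<in>I. norm (g v - g u)) < e)"

definition locally_abs_continuous_from ::
    "real \<Rightarrow> (real \<Rightarrow> 'a::real_normed_vector) \<Rightarrow> bool"
  where "locally_abs_continuous_from t0 g \<longleftrightarrow>
    (\<forall>a b. t0 \<le> a \<and> a \<le> b \<longrightarrow> abs_continuous_on_interval a b g)"

definition global_solution ::
    "('a::{real_inner,banach} \<Rightarrow> real) \<Rightarrow> ('a \<Rightarrow> 'b::{real_inner,banach}) \<Rightarrow> 'b \<Rightarrow>
     real \<Rightarrow> real \<Rightarrow> real \<Rightarrow> real \<Rightarrow> (real \<Rightarrow> real) \<Rightarrow> (real \<Rightarrow> 'a) \<Rightarrow>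
     (real \<Rightarrow> 'a) \<Rightarrow> (real \<Rightarrow> 'b) \<Rightarrow> bool"
  where "global_solution f A b t0 \<alpha> \<delta> \<sigma> \<beta> \<epsilon> x l \<longleftrightarrow>
    (\<exists>x' x'' l' l''.
      C2_from t0 x x' x'' \<and> C2_from t0 l l' l'' \<and>
      locally_abs_continuous_from t0 (\<lambda>t. (x t, l t)) \<and>
      locally_abs_continuous_from t0 (\<lambda>t. (x' t, l' t)) \<and>
      (AE t in lebesgue. t \<ge> t0 \<longrightarrow>
        x'' t + \<alpha> *\<^sub>R x' t =
          - (\<beta> t *\<^sub>R (gradient f (x t) + adjoint A (l t + \<delta> *\<^sub>R l' t)
                      + \<sigma> *\<^sub>R adjoint A (A (x t) - b))) + \<epsilon> t \<and>
        l'' t + \<alpha> *\<^sub>R l' t = \<beta> t *\<^sub>R (A (x t + \<delta> *\<^sub>R x' t) - b)))"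

end

theory Submission
  imports Defs
begin

text \<open>Along a trajectory write \<open>w = x - xs\<close>, \<open>v = l - ls\<close> and
  \<open>\<Phi> = f x - f xs + \<langle>ls, A w\<rangle> + \<sigma>/2 \<parallel>A w\<parallel>\<^sup>2 \<ge> 0\<close>. Since \<open>\<beta>' = \<beta> / \<delta>\<close>, the energy
  \<open>E = \<delta>\<^sup>2 \<beta> \<Phi> + \<parallel>w + \<delta> x'\<parallel>\<^sup>2/2 + (\<alpha> \<delta> - 1) \<parallel>w\<parallel>\<^sup>2/2 + \<parallel>v + \<delta> l'\<parallel>\<^sup>2/2 + (\<alpha> \<delta> - 1) \<parallel>v\<parallel>\<^sup>2/2\<close>
  satisfies \<open>E' \<le> \<delta> \<langle>w + \<delta> x', \<epsilon>\<rangle>\<close>, so it is bounded by a Gronwall argument, which gives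
  \<open>\<Phi> = O(1/\<beta>)\<close> and bounds \<open>l\<close> and \<open>l'\<close>. The second equation says that
  \<open>l' + \<alpha> l - \<delta> \<beta> A w\<close> is constant, whence \<open>\<parallel>A w\<parallel> = O(1/\<beta>)\<close>; the bound on \<open>f x - f xs\<close>
  follows from these two.\<close>

section \<open>Riesz representation and adjoints in Hilbert space\<close>

lemma quadratic_nonneg_imp_linear_coeff_0:
  fixes c d :: real
  assumes "\<And>s. 0 \<le> 2 * s * c + s\<^sup>2 * d" "d \<ge> 0"
  shows "c = 0"
proof (rule ccontr)
  assume c: "c \<noteq> 0"
  \<comment> \<open>The minimiser would be \<open>- c / d\<close>; the shift to \<open>d + 1\<close>
    also covers \<open>d = 0\<close> and still makes the quadratic negative.\<close>
  define s where "s = - c / (d + 1)"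
  have s: "s * (d + 1) = - c" using assms(2) by (simp add: s_def)
  have "0 \<le> (2 * s * c + s\<^sup>2 * d) * (d + 1)\<^sup>2"
    by (intro mult_nonneg_nonneg assms) simp
  also have "\<dots> = 2 * (s * (d + 1)) * (d + 1) * c + (s * (d + 1))\<^sup>2 * d"
    by (simp add: power2_eq_square algebra_simps)
  also have "\<dots> = - (c\<^sup>2 * (d + 2))"
    unfolding s by (simp add: power2_eq_square algebra_simps)
  also have "\<dots> < 0" using c assms(2) by simp
  finally show False by simp
qed

text \<open>The representing vector minimises \<open>J y = \<langle>y, y\<rangle> - 2 \<phi> y\<close>; a minimising sequence is Cauchy
  by the parallelogram law.\<close>

theorem riesz_representation:
  fixes \<phi> :: "'a::{real_inner,banach} \<Rightarrow> real"
  assumes "bounded_linear \<phi>"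
  shows "\<exists>g. \<forall>h. \<phi> h = g \<bullet> h"
proof -
  interpret bounded_linear \<phi> by fact
  define J where "J y = y \<bullet> y - 2 * \<phi> y" for y
  obtain K where K: "\<And>y. norm (\<phi> y) \<le> norm y * K" using bounded by blast
  have lower: "- (K\<^sup>2) \<le> J y" for y
  proof -
    \<comment> \<open>Completing the square in \<open>norm y\<close>, after \<open>\<phi> y\<close>
      is bounded by \<open>norm y * K\<close>.\<close>
    have "0 \<le> (norm y - K)\<^sup>2" by simp
    then have "- (K\<^sup>2) \<le> norm y * norm y - 2 * (norm y * K)"
      by (simp add: power2_eq_square algebra_simps)
    also have "\<dots> \<le> J y"
      using K[of y] by (simp add: J_def dot_square_norm power2_eq_square)
    finally show ?thesis .
  qed
  define m where "m = Inf (range J)"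
  have bdd: "bdd_below (range J)" unfolding bdd_below_def using lower by blast
  have m_le: "m \<le> J y" for y unfolding m_def by (rule cInf_lower[OF _ bdd]) simp
  have "\<exists>y. J y < m + inverse (real (Suc n))" for n
    using cInf_lessD[of "range J" "m + inverse (real (Suc n))"] by (auto simp: m_def)
  then obtain y where y: "\<And>n. J (y n) < m + inverse (real (Suc n))" by metis
  have par: "(norm (u - v))\<^sup>2 \<le> 2 * (J u + J v - 2 * m)" for u v
  proof -
    \<comment> \<open>The \<open>\<phi>\<close> terms cancel at the midpoint by linearity, which
      leaves the parallelogram law.\<close>
    have "J u + J v - 2 * J ((1/2) *\<^sub>R (u + v)) = (norm (u - v))\<^sup>2 / 2"
      unfolding J_def scaleR add power2_norm_eq_inner
      by (simp add: inner_simps inner_commute field_simps)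
    moreover have "m \<le> J ((1/2) *\<^sub>R (u + v))" by (rule m_le)
    ultimately show ?thesis by simp
  qed
  have "Cauchy y"
  proof (rule metric_CauchyI)
    fix e :: real assume e: "e > 0"
    \<comment> \<open>With this threshold \<open>par\<close> turns two excesses over
      \<open>m\<close> below \<open>e\<^sup>2 / 4\<close> into a squared distance below
      \<open>e\<^sup>2\<close>.\<close>
    then obtain N where N: "inverse (real (Suc N)) < e\<^sup>2 / 4"
      using reals_Archimedean[of "e\<^sup>2/4"] by auto
    have "dist (y p) (y q) < e" if "p \<ge> N" "q \<ge> N" for p q
    proof -
      have "inverse (real (Suc p)) \<le> inverse (real (Suc N))"
        "inverse (real (Suc q)) \<le> inverse (real (Suc N))"
        using that by (auto intro!: le_imp_inverse_le)
      with y[of p] y[of q] N have "J (y p) < m + e\<^sup>2 / 4" "J (y q) < m + e\<^sup>2 / 4"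
        by (meson add_strict_left_mono less_trans order_le_less_trans)+
      with par[of "y p" "y q"] have "(norm (y p - y q))\<^sup>2 < e\<^sup>2" by argo
      then show ?thesis using e by (simp add: dist_norm power_less_imp_less_base)
    qed
    then show "\<exists>M. \<forall>p\<ge>M. \<forall>q\<ge>M. dist (y p) (y q) < e" by blast
  qed
  then obtain g where g: "y \<longlonglongrightarrow> g" using Cauchy_convergent_iff convergent_def by blast
  have "(\<lambda>n. J (y n)) \<longlonglongrightarrow> J g"
    unfolding J_def by (intro tendsto_intros g tendsto)
  moreover have "(\<lambda>n. m + inverse (real (Suc n))) \<longlonglongrightarrow> m"
    by (rule LIMSEQ_inverse_real_of_nat_add)
  ultimately have "J g \<le> m"
    using y by (intro LIMSEQ_le[of "\<lambda>n. J (y n)" _ "\<lambda>n. m + inverse (real (Suc n))"])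
      (auto intro: less_imp_le)
  then have min: "J g \<le> J h" for h using m_le[of h] by linarith
  \<comment> \<open>First-order condition: minimality of \<open>g\<close> along
    \<open>g + s *\<^sub>R h\<close> is nonnegativity of a quadratic in \<open>s\<close>, so its
    linear coefficient vanishes.\<close>
  have "g \<bullet> h - \<phi> h = 0" for h
  proof (rule quadratic_nonneg_imp_linear_coeff_0)
    show "0 \<le> 2 * s * (g \<bullet> h - \<phi> h) + s\<^sup>2 * (h \<bullet> h)" for s
      using min[of "g + s *\<^sub>R h"]
      by (simp add: J_def add scaleR inner_simps inner_commute power2_eq_square algebra_simps)
  qed simp
  then show ?thesis by (intro exI[of _ g]) auto
qed

text \<open>\<open>adjoint\<close> is a choice among the maps satisfying this identity, so existence
  has to come first; the Riesz vectors of the functionals \<open>\<lambda>h. A h \<bullet> y\<close>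
  supply it.\<close>

lemma adjoint_inner:
  fixes A :: "'a::{real_inner,banach} \<Rightarrow> 'b::real_inner"
  assumes "bounded_linear A"
  shows "A u \<bullet> y = u \<bullet> adjoint A y"
proof -
  have "\<exists>g. \<forall>h. A h \<bullet> y = g \<bullet> h" for y
    by (rule riesz_representation)
      (rule bounded_linear_compose[OF bounded_linear_inner_left assms])
  then obtain g where g: "\<And>y h. A h \<bullet> y = g y \<bullet> h" by metis
  then have "adjoint A = g" by (intro adjoint_unique) (simp add: inner_commute)
  then show ?thesis using g by (simp add: inner_commute)
qed

text \<open>Linearity holds because inner products separate points. A bound \<open>K\<close> of
  \<open>A\<close> carries over by Cauchy-Schwarz applied to
  \<open>A (adjoint A y) \<bullet> y\<close>, the squared norm of \<open>adjoint A y\<close>, and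
  division by that norm.\<close>

lemma bounded_linear_adjoint:
  fixes A :: "'a::{real_inner,banach} \<Rightarrow> 'b::real_inner"
  assumes "bounded_linear A"
  shows "bounded_linear (adjoint A)"
proof -
  note adj = adjoint_inner[OF assms, symmetric]
  obtain K where "K \<ge> 0" and K: "\<And>u. norm (A u) \<le> norm u * K"
    using bounded_linear.nonneg_bounded[OF assms] by blast
  show ?thesis
  proof (rule bounded_linear_intro[where K = K])
    show "adjoint A (y + z) = adjoint A y + adjoint A z" for y z
      by (rule vector_eq_ldot[THEN iffD1]) (simp add: adj inner_simps)
    show "adjoint A (r *\<^sub>R y) = r *\<^sub>R adjoint A y" for r y
      by (rule vector_eq_ldot[THEN iffD1]) (simp add: adj inner_simps)
    show "norm (adjoint A y) \<le> norm y * K" for y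
    proof (cases "adjoint A y = 0")
      case True
      then show ?thesis using \<open>K \<ge> 0\<close> by simp
    next
      case False
      have "norm (adjoint A y) * norm (adjoint A y) = A (adjoint A y) \<bullet> y"
        by (simp add: adj[symmetric] dot_square_norm power2_eq_square)
      also have "\<dots> \<le> norm (A (adjoint A y)) * norm y" by (rule norm_cauchy_schwarz)
      also have "\<dots> \<le> norm (adjoint A y) * K * norm y" by (intro mult_right_mono K) simp
      finally show ?thesis using False by (simp add: mult.assoc mult.commute)
    qed
  qed
qed

section \<open>Gradients and convexity\<close>

text \<open>The definite description in \<open>gradient\<close> is proper: Riesz turns the
  derivative into a vector, and uniqueness of the Frechet derivative makes it the only one.\<close>

lemma GDERIV_gradient:
  fixes f :: "'a::{real_inner,banach} \<Rightarrow> real"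
  assumes "f differentiable (at u)"
  shows "GDERIV f u :> gradient f u"
proof -
  obtain D where D: "(f has_derivative D) (at u)" using assms by (auto simp: differentiable_def)
  then obtain g where "\<And>h. D h = g \<bullet> h"
    using riesz_representation[OF has_derivative_bounded_linear] by blast
  then have g: "GDERIV f u :> g"
    using D by (simp add: gderiv_def inner_commute[of _ g]) (metis eta_contract_eq ext)
  have "g' = g" if "GDERIV f u :> g'" for g'
    using has_derivative_unique[OF g[unfolded gderiv_def] that[unfolded gderiv_def]]
    by (metis vector_eq_ldot)
  with g show ?thesis unfolding gradient_def by (metis theI)
qed

lemma GDERIV_chain:
  fixes f :: "'a::real_inner \<Rightarrow> real" and x :: "real \<Rightarrow> 'a"
  assumes "GDERIV f (x t) :> g" "(x has_vector_derivative x') (at t)"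
  shows "((\<lambda>t. f (x t)) has_real_derivative x' \<bullet> g) (at t)"
proof -
  have "((\<lambda>t. f (x t)) has_derivative (\<lambda>s. (s *\<^sub>R x') \<bullet> g)) (at t)"
    using assms unfolding gderiv_def has_vector_derivative_def
    by (rule has_derivative_compose[rotated])
  then show ?thesis by (simp add: has_field_derivative_def mult.commute[of _ "x' \<bullet> g"])
qed

text \<open>On the line through \<open>u\<close> and \<open>v\<close> this is the tangent bound for
  a convex function of one real variable, with tangent at 0 and value at 1.\<close>

lemma convex_on_gradient_inequality:
  fixes f :: "'a::real_inner \<Rightarrow> real"
  assumes "convex_on UNIV f" "GDERIV f u :> g"
  shows "f u + (v - u) \<bullet> g \<le> f v"
proof -
  define \<phi> where "\<phi> s = f (u + s *\<^sub>R (v - u))" for s :: real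
  have "convex_on UNIV \<phi>"
  proof (rule convex_onI)
    fix t r s :: real assume "0 < t" "t < 1"
    moreover have "u + ((1 - t) *\<^sub>R r + t *\<^sub>R s) *\<^sub>R (v - u)
        = (1 - t) *\<^sub>R (u + r *\<^sub>R (v - u)) + t *\<^sub>R (u + s *\<^sub>R (v - u))"
      by (simp add: algebra_simps)
    ultimately show "\<phi> ((1 - t) *\<^sub>R r + t *\<^sub>R s) \<le> (1 - t) * \<phi> r + t * \<phi> s"
      using convex_onD[OF assms(1), of t "u + r *\<^sub>R (v - u)" "u + s *\<^sub>R (v - u)"]
      by (simp add: \<phi>_def)
  qed simp
  moreover have "(\<phi> has_real_derivative (v - u) \<bullet> g) (at 0)"
    unfolding \<phi>_def using assms(2)
    by (intro GDERIV_chain) (auto intro!: derivative_eq_intros)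
  ultimately have "\<phi> 1 - \<phi> 0 \<ge> ((v - u) \<bullet> g) * (1 - 0)"
    by (intro convex_on_imp_above_tangent[of UNIV]) auto
  then show ?thesis by (simp add: \<phi>_def)
qed

section \<open>Gronwall estimate and removal of null sets\<close>

text \<open>Integrating factor: with \<open>N\<close> a primitive of \<open>k\<close>, the product
  \<open>(1 + E) * exp (- N)\<close> is nonincreasing from \<open>T\<close> on.\<close>

lemma gronwall_bound:
  fixes E E' k :: "real \<Rightarrow> real"
  assumes "t0 < T" "T \<le> t"
    and k: "continuous_on {t0..} k"
    and int_k: "integral {t0..T} k \<ge> 0" "integral {t0..t} k \<le> M"
    and E: "\<And>s. T \<le> s \<Longrightarrow> (E has_real_derivative E' s) (at s)"
    and E': "\<And>s. T \<le> s \<Longrightarrow> E' s \<le> k s * (1 + E s)"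
    and "E T \<ge> 0"
  shows "E t \<le> (1 + E T) * exp M"
proof -
  define N where "N s = integral {t0..s} k" for s
  have N: "(N has_real_derivative k s) (at s)" if "s > t0" for s
  proof -
    \<comment> \<open>The interval extends past \<open>s\<close> so that \<open>s\<close> is
      interior and the derivative is two-sided.\<close>
    have "(N has_real_derivative k s) (at s within {t0..s+1})"
      unfolding N_def using that
      by (intro integral_has_real_derivative continuous_on_subset[OF k]) auto
    then show ?thesis using that by (simp add: at_within_Icc_at)
  qed
  have "(1 + E t) * exp (- N t) \<le> (1 + E T) * exp (- N T)"
  proof (rule DERIV_nonpos_imp_nonincreasing[OF \<open>T \<le> t\<close>])
    fix s assume s: "T \<le> s"
    have "((\<lambda>s. (1 + E s) * exp (- N s)) has_real_derivative
        (E' s - k s * (1 + E s)) * exp (- N s)) (at s)"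
      using s \<open>t0 < T\<close> by (auto intro!: derivative_eq_intros E N simp: algebra_simps)
    moreover have "(E' s - k s * (1 + E s)) * exp (- N s) \<le> 0"
      using E'[OF s] by (simp add: mult_nonpos_nonneg)
    ultimately show "\<exists>y. ((\<lambda>s. (1 + E s) * exp (- N s)) has_real_derivative y) (at s) \<and> y \<le> 0"
      by blast
  qed
  then have "1 + E t \<le> (1 + E T) * exp (N t - N T)"
    by (simp add: exp_minus exp_diff field_simps)
  \<comment> \<open>\<open>N T \<ge> 0\<close> and \<open>N t \<le> M\<close> bound the exponent by
    \<open>M\<close>.\<close>
  also have "\<dots> \<le> (1 + E T) * exp M"
    using assms by (intro mult_left_mono) (auto simp: N_def)
  finally show ?thesis by simp
qed

lemma AE_lebesgue_negligibleE:
  assumes "AE t in lebesgue. P t"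
  obtains N where "negligible N" "\<And>t. t \<notin> N \<Longrightarrow> P t"
  using assms unfolding eventually_ae_filter negligible_iff_null_sets by auto

text \<open>The points of the open half-line where \<open>r\<close> is nonzero form an open set
  inside a null set; such a set is empty.\<close>

lemma continuous_AE_eq_0:
  fixes r :: "real \<Rightarrow> 'a::real_normed_vector"
  assumes "continuous_on {t0..} r" "AE t in lebesgue. t \<ge> t0 \<longrightarrow> r t = 0" "t > t0"
  shows "r t = 0"
proof (rule ccontr)
  assume "r t \<noteq> 0"
  define U where "U = r -` (- {0}) \<inter> {t0<..}"
  have "continuous_on {t0<..} r" using assms(1) by (rule continuous_on_subset) auto
  then have "open U" unfolding U_def by (subst (asm) continuous_on_open_vimage) auto
  moreover have "t \<in> U" using \<open>r t \<noteq> 0\<close> \<open>t > t0\<close> by (simp add: U_def)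
  moreover obtain N where N: "negligible N" "\<And>t. t \<notin> N \<Longrightarrow> t \<ge> t0 \<longrightarrow> r t = 0"
    using AE_lebesgue_negligibleE[OF assms(2)] by metis
  then have "U \<subseteq> N" by (force simp: U_def)
  ultimately show False
    using open_not_negligible negligible_subset[OF N(1)] by blast
qed

text \<open>Transfers integrability of a forcing term to a continuous representative: null sets do
  not affect the integral, and truncation can only lower it for \<open>g \<ge> 0\<close>.\<close>

lemma integral_le_AE_eq:
  fixes g h :: "real \<Rightarrow> real"
  assumes g: "continuous_on {t0..} g" "\<And>s. s \<ge> t0 \<Longrightarrow> 0 \<le> g s"
    and h: "set_integrable lebesgue {t0..} h"
    and eq: "AE t in lebesgue. t \<ge> t0 \<longrightarrow> g t = h t"
  shows "integral {t0..t} g \<le> integral {t0..} h"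
proof -
  obtain N where N: "negligible N" "\<And>t. t \<notin> N \<Longrightarrow> t \<ge> t0 \<longrightarrow> g t = h t"
    using AE_lebesgue_negligibleE[OF eq] by metis
  have "h integrable_on {t0..}" using h by (simp add: absolutely_integrable_on_def)
  then have "g integrable_on {t0..}" by (rule integrable_spike[OF _ N(1)]) (use N(2) in auto)
  moreover have "g integrable_on {t0..t}"
    by (intro integrable_continuous_real continuous_on_subset[OF g(1)]) auto
  ultimately have "integral {t0..t} g \<le> integral {t0..} g"
    using g(2) by (intro integral_subset_le) auto
  also have "\<dots> = integral {t0..} h" using N by (intro integral_spike[of N]) auto
  finally show ?thesis .
qed

section \<open>Derivatives of quadratic energies\<close>

lemma has_real_derivative_inner:
  fixes u v :: "real \<Rightarrow> 'a::real_inner"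
  assumes "(u has_vector_derivative u') (at t)" "(v has_vector_derivative v') (at t)"
  shows "((\<lambda>t. u t \<bullet> v t) has_real_derivative u t \<bullet> v' + u' \<bullet> v t) (at t)"
  unfolding has_field_derivative_def
  by (rule has_derivative_eq_rhs[OF has_derivative_inner[OF assms[unfolded has_vector_derivative_def]]])
    (simp add: fun_eq_iff algebra_simps)

text \<open>Serves the primal and the dual variable alike. Since \<open>p + \<delta> q = \<delta> (q
  + \<alpha> p) - (\<alpha> \<delta> - 1) p\<close>, the weight
  \<open>\<alpha> * \<delta> - 1\<close> is the one that cancels the mixed term
  \<open>w \<bullet> p\<close>.\<close>

lemma damped_energy_derivative:
  fixes w p :: "real \<Rightarrow> 'a::real_inner"
  assumes w: "(w has_vector_derivative p t) (at t)" and p: "(p has_vector_derivative q) (at t)"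
  shows "((\<lambda>t. ((w t + \<delta> *\<^sub>R p t) \<bullet> (w t + \<delta> *\<^sub>R p t) + (\<alpha> * \<delta> - 1) * (w t \<bullet> w t)) / 2)
    has_real_derivative
      \<delta> * ((w t + \<delta> *\<^sub>R p t) \<bullet> (q + \<alpha> *\<^sub>R p t)) - \<delta> * (\<alpha> * \<delta> - 1) * (p t \<bullet> p t)) (at t)"
proof -
  have "((\<lambda>t. w t + \<delta> *\<^sub>R p t) has_vector_derivative p t + \<delta> *\<^sub>R q) (at t)"
    by (intro has_vector_derivative_add w bounded_linear.has_vector_derivative[OF bounded_linear_scaleR_right] p)
  from DERIV_cdivide[OF DERIV_add[OF has_real_derivative_inner[OF this this]
      DERIV_cmult[OF has_real_derivative_inner[OF w w], of "\<alpha> * \<delta> - 1"]], of 2]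
  show ?thesis
    by (rule DERIV_cong) (simp add: inner_simps inner_commute field_simps)
qed

section \<open>Energy of a trajectory\<close>

text \<open>The setting once null sets are gone: the equations hold at every \<open>t > t0\<close>,
  where derivatives are two-sided, and gradient and adjoint enter through their characteristic
  identities.\<close>

locale primal_dual_trajectory =
  fixes f :: "'a::real_inner \<Rightarrow> real" and grad :: "'a \<Rightarrow> 'a"
    and A :: "'a \<Rightarrow> 'b::real_inner" and At :: "'b \<Rightarrow> 'a" and b :: 'b
    and xs :: 'a and ls :: 'b
    and x x' x'' e :: "real \<Rightarrow> 'a" and l l' l'' :: "real \<Rightarrow> 'b"
    and t0 \<alpha> \<delta> \<sigma> \<mu> :: real and \<beta> :: "real \<Rightarrow> real"
  defines "\<beta> \<equiv> \<lambda>t. \<mu> * exp (t / \<delta>)"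
  assumes A: "bounded_linear A" and adj: "\<And>u y. A u \<bullet> y = u \<bullet> At y"
    and grad: "\<And>u. GDERIV f u :> grad u" and convex: "convex_on UNIV f"
    and \<alpha>: "\<alpha> > 0" and \<delta>: "\<delta> > 0" and \<alpha>\<delta>: "\<alpha> * \<delta> > 1" and \<sigma>: "\<sigma> \<ge> 0" and \<mu>: "\<mu> > 0"
    and feasible: "A xs = b" and saddle: "\<And>u. f xs \<le> f u + ls \<bullet> (A u - b)"
    and x: "\<And>t. t > t0 \<Longrightarrow> (x has_vector_derivative x' t) (at t)"
    and x': "\<And>t. t > t0 \<Longrightarrow> (x' has_vector_derivative x'' t) (at t)"
    and l: "\<And>t. t > t0 \<Longrightarrow> (l has_vector_derivative l' t) (at t)"
    and l': "\<And>t. t > t0 \<Longrightarrow> (l' has_vector_derivative l'' t) (at t)"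
    and eq_x: "\<And>t. t > t0 \<Longrightarrow> x'' t + \<alpha> *\<^sub>R x' t =
      - (\<beta> t *\<^sub>R (grad (x t) + At (l t + \<delta> *\<^sub>R l' t) + \<sigma> *\<^sub>R At (A (x t) - b))) + e t"
    and eq_l: "\<And>t. t > t0 \<Longrightarrow>
      l'' t + \<alpha> *\<^sub>R l' t = \<beta> t *\<^sub>R (A (x t + \<delta> *\<^sub>R x' t) - b)"
    and cont_e: "continuous_on {t0..} e"
    and int_e: "\<exists>M. \<forall>t\<ge>t0. integral {t0..t} (\<lambda>s. norm (e s)) \<le> M"
begin

interpretation A: bounded_linear A by (rule A)

lemma \<beta>_pos: "\<beta> t > 0"
  using \<mu> by (simp add: \<beta>_def)

lemma \<beta>_deriv: "(\<beta> has_real_derivative \<beta> t / \<delta>) (at t)"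
  unfolding \<beta>_def using \<delta> by (auto intro!: derivative_eq_intros)

lemma residual_deriv:
  assumes "t > t0"
  shows "((\<lambda>t. A (x t) - b) has_vector_derivative A (x' t)) (at t)"
  using has_vector_derivative_diff[OF A.has_vector_derivative[OF x[OF assms]]
      has_vector_derivative_const] by simp

text \<open>The augmented Lagrangian with multiplier \<open>ls\<close>, at \<open>x t\<close> minus
  at \<open>xs\<close>; its penalty produces the \<open>\<sigma>\<close> term of
  \<open>eq_x\<close>.\<close>

definition gap :: "real \<Rightarrow> real" where
  "gap t = f (x t) - f xs + ls \<bullet> (A (x t) - b) + \<sigma> / 2 * ((A (x t) - b) \<bullet> (A (x t) - b))"

lemma gap_nonneg: "gap t \<ge> 0"
  using saddle[of "x t"] \<sigma> by (simp add: gap_def)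

lemma gap_deriv:
  assumes "t > t0"
  shows "(gap has_real_derivative
    x' t \<bullet> grad (x t) + ls \<bullet> A (x' t) + \<sigma> * ((A (x t) - b) \<bullet> A (x' t))) (at t)"
proof -
  note r = residual_deriv[OF assms]
  have "((\<lambda>t. f (x t) - f xs) has_real_derivative x' t \<bullet> grad (x t) - 0) (at t)"
    by (intro DERIV_diff GDERIV_chain grad x assms DERIV_const)
  from DERIV_add[OF DERIV_add[OF this has_real_derivative_inner[OF has_vector_derivative_const r]]
      DERIV_cmult[OF has_real_derivative_inner[OF r r], of "\<sigma>/2"]]
  show ?thesis
    unfolding gap_def by (rule DERIV_cong) (simp add: inner_commute)
qed

definition energy :: "real \<Rightarrow> real" where
  "energy t = \<delta>\<^sup>2 * (\<beta> t * gap t)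
    + ((x t - xs + \<delta> *\<^sub>R x' t) \<bullet> (x t - xs + \<delta> *\<^sub>R x' t)
        + (\<alpha> * \<delta> - 1) * ((x t - xs) \<bullet> (x t - xs))) / 2
    + ((l t - ls + \<delta> *\<^sub>R l' t) \<bullet> (l t - ls + \<delta> *\<^sub>R l' t)
        + (\<alpha> * \<delta> - 1) * ((l t - ls) \<bullet> (l t - ls))) / 2"

lemma energy_bounds:
  shows "\<delta>\<^sup>2 * (\<beta> t * gap t) \<le> energy t"
    and "(norm (x t - xs + \<delta> *\<^sub>R x' t))\<^sup>2 \<le> 2 * energy t"
    and "(norm (l t - ls + \<delta> *\<^sub>R l' t))\<^sup>2 \<le> 2 * energy t"
    and "(\<alpha> * \<delta> - 1) * (norm (l t - ls))\<^sup>2 \<le> 2 * energy t"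
    and "energy t \<ge> 0"
proof -
  define g where "g = \<delta>\<^sup>2 * (\<beta> t * gap t)"
  define p q where "p = (norm (x t - xs + \<delta> *\<^sub>R x' t))\<^sup>2" and "q = (\<alpha> * \<delta> - 1) * (norm (x t - xs))\<^sup>2"
  define r s where "r = (norm (l t - ls + \<delta> *\<^sub>R l' t))\<^sup>2" and "s = (\<alpha> * \<delta> - 1) * (norm (l t - ls))\<^sup>2"
  have "2 * energy t = 2 * g + p + q + r + s"
    unfolding energy_def g_def p_def q_def r_def s_def power2_norm_eq_inner by (simp add: field_simps)
  moreover have "g \<ge> 0" "p \<ge> 0" "q \<ge> 0" "r \<ge> 0" "s \<ge> 0"
    using \<alpha>\<delta> \<beta>_pos[of t] gap_nonneg[of t] by (simp_all add: g_def p_def q_def r_def s_def)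
  ultimately have "g \<le> energy t" "p \<le> 2 * energy t" "r \<le> 2 * energy t" "s \<le> 2 * energy t"
    "energy t \<ge> 0"
    by simp_all
  then show "\<delta>\<^sup>2 * (\<beta> t * gap t) \<le> energy t"
    "(norm (x t - xs + \<delta> *\<^sub>R x' t))\<^sup>2 \<le> 2 * energy t"
    "(norm (l t - ls + \<delta> *\<^sub>R l' t))\<^sup>2 \<le> 2 * energy t"
    "(\<alpha> * \<delta> - 1) * (norm (l t - ls))\<^sup>2 \<le> 2 * energy t"
    "energy t \<ge> 0"
    unfolding g_def p_def r_def s_def by auto
qed

lemma energy_deriv:
  assumes t: "t > t0"
  shows "\<exists>D. (energy has_real_derivative D) (at t) \<and> D \<le> \<delta> * norm (e t) * (1 + energy t)"
proof -
  define w v p r where "w = x t - xs" and "v = l t - ls" and "p = x' t" and "r = l' t"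
  have Aw: "A (x t) - b = A w" by (simp add: w_def A.diff feasible)
  have dw: "((\<lambda>t. x t - xs) has_vector_derivative x' t) (at t)"
    using has_vector_derivative_diff[OF x[OF t] has_vector_derivative_const] by simp
  have dv: "((\<lambda>t. l t - ls) has_vector_derivative l' t) (at t)"
    using has_vector_derivative_diff[OF l[OF t] has_vector_derivative_const] by simp
  define dgap where "dgap = p \<bullet> grad (x t) + ls \<bullet> A p + \<sigma> * (A w \<bullet> A p)"
  define D where "D = \<delta>\<^sup>2 * (\<beta> t / \<delta> * gap t + dgap * \<beta> t)
    + (\<delta> * ((w + \<delta> *\<^sub>R p) \<bullet> (x'' t + \<alpha> *\<^sub>R p)) - \<delta> * (\<alpha> * \<delta> - 1) * (p \<bullet> p))
    + (\<delta> * ((v + \<delta> *\<^sub>R r) \<bullet> (l'' t + \<alpha> *\<^sub>R r)) - \<delta> * (\<alpha> * \<delta> - 1) * (r \<bullet> r))"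
  have "(gap has_real_derivative dgap) (at t)"
    using gap_deriv[OF t] unfolding Aw dgap_def p_def .
  then have deriv: "(energy has_real_derivative D) (at t)"
    unfolding energy_def D_def w_def v_def p_def r_def
    by (intro DERIV_add DERIV_cmult DERIV_mult \<beta>_deriv damped_energy_derivative
        dw dv x'[OF t] l'[OF t])
  \<comment> \<open>The multiplier is split at \<open>ls\<close>: the \<open>ls\<close> part belongs
    to the derivative of \<open>gap\<close>, and the \<open>v + \<delta> r\<close> part is cancelled
    by \<open>l_part\<close>.\<close>
  have x_part: "(w + \<delta> *\<^sub>R p) \<bullet> (x'' t + \<alpha> *\<^sub>R p) =
      - (\<beta> t * ((w + \<delta> *\<^sub>R p) \<bullet> grad (x t) + A (w + \<delta> *\<^sub>R p) \<bullet> (ls + (v + \<delta> *\<^sub>R r))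
          + \<sigma> * (A (w + \<delta> *\<^sub>R p) \<bullet> A w))) + (w + \<delta> *\<^sub>R p) \<bullet> e t"
  proof -
    have "l t + \<delta> *\<^sub>R l' t = ls + (v + \<delta> *\<^sub>R r)" by (simp add: v_def r_def)
    then show ?thesis
      using eq_x[OF t] unfolding Aw p_def[symmetric]
      by (simp only: adj inner_add_right[of "w + \<delta> *\<^sub>R p"] inner_minus_right inner_scaleR_right)
  qed
  have "x t + \<delta> *\<^sub>R x' t = xs + (w + \<delta> *\<^sub>R p)" by (simp add: w_def p_def)
  then have "A (x t + \<delta> *\<^sub>R x' t) - b = A (w + \<delta> *\<^sub>R p)"
    by (simp only: A.add feasible) simp
  then have l_part: "(v + \<delta> *\<^sub>R r) \<bullet> (l'' t + \<alpha> *\<^sub>R r) = \<beta> t * (A (w + \<delta> *\<^sub>R p) \<bullet> (v + \<delta> *\<^sub>R r))"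
    using eq_l[OF t] by (simp add: r_def inner_commute)
  \<comment> \<open>The weight \<open>\<delta>\<^sup>2\<close> makes \<open>dgap\<close> cancel the
    \<open>p\<close> part of the force. The remaining \<open>\<delta> * \<beta> t * gap t\<close>,
    from \<open>\<beta>' = \<beta> / \<delta>\<close>, joins the \<open>w\<close> part, where the
    \<open>ls\<close> terms cancel and the penalty changes sign.\<close>
  have "D = \<delta> * \<beta> t * (f (x t) - f xs - w \<bullet> grad (x t) - \<sigma> / 2 * (A w \<bullet> A w))
      - \<delta> * (\<alpha> * \<delta> - 1) * (p \<bullet> p) - \<delta> * (\<alpha> * \<delta> - 1) * (r \<bullet> r) + \<delta> * ((w + \<delta> *\<^sub>R p) \<bullet> e t)"
    unfolding D_def x_part l_part gap_def dgap_def Aw using \<delta>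
    by (simp add: A.add A.scaleR inner_add_left inner_add_right inner_commute
        power2_eq_square field_simps)
  moreover have "f (x t) - f xs - w \<bullet> grad (x t) - \<sigma> / 2 * (A w \<bullet> A w) \<le> 0"
  proof -
    have "f (x t) + (xs - x t) \<bullet> grad (x t) \<le> f xs"
      by (rule convex_on_gradient_inequality[OF convex grad])
    moreover have "(xs - x t) \<bullet> grad (x t) = - (w \<bullet> grad (x t))"
      by (simp add: w_def inner_diff_left)
    moreover have "\<sigma> / 2 * (A w \<bullet> A w) \<ge> 0" using \<sigma> by simp
    ultimately show ?thesis by linarith
  qed
  then have "\<delta> * \<beta> t * (f (x t) - f xs - w \<bullet> grad (x t) - \<sigma> / 2 * (A w \<bullet> A w)) \<le> 0"
    using \<delta> \<beta>_pos[of t] by (intro mult_nonneg_nonpos) auto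
  moreover have "0 \<le> \<delta> * (\<alpha> * \<delta> - 1) * (p \<bullet> p)" "0 \<le> \<delta> * (\<alpha> * \<delta> - 1) * (r \<bullet> r)"
    using \<delta> \<alpha>\<delta> by simp_all
  moreover have "\<delta> * ((w + \<delta> *\<^sub>R p) \<bullet> e t) \<le> \<delta> * (norm (e t) * (1 + energy t))"
  proof (rule mult_left_mono)
    \<comment> \<open>The energy controls the square of this norm;
      \<open>2 n \<le> n\<^sup>2 + 1\<close> yields a bound linear in the energy, as Gronwall
      requires.\<close>
    have "(norm (w + \<delta> *\<^sub>R p) - 1)\<^sup>2 \<ge> 0" by simp
    then have "norm (w + \<delta> *\<^sub>R p) \<le> 1 + energy t"
      using energy_bounds(2)[of t] by (simp add: w_def p_def power2_eq_square algebra_simps)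
    then have "norm (w + \<delta> *\<^sub>R p) * norm (e t) \<le> (1 + energy t) * norm (e t)"
      by (rule mult_right_mono) simp
    then show "(w + \<delta> *\<^sub>R p) \<bullet> e t \<le> norm (e t) * (1 + energy t)"
      using norm_cauchy_schwarz[of "w + \<delta> *\<^sub>R p" "e t"] by (simp add: mult.commute)
  qed (use \<delta> in simp)
  ultimately have "D \<le> \<delta> * norm (e t) * (1 + energy t)" by (simp add: mult.assoc)
  with deriv show ?thesis by blast
qed

lemma energy_bounded: "\<exists>C. \<forall>t\<ge>t0 + 1. energy t \<le> C"
proof -
  obtain M where M: "\<And>t. t \<ge> t0 \<Longrightarrow> integral {t0..t} (\<lambda>s. norm (e s)) \<le> M"
    using int_e by blast
  obtain D where D: "\<And>t. t > t0 \<Longrightarrow> (energy has_real_derivative D t) (at t)"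
    "\<And>t. t > t0 \<Longrightarrow> D t \<le> \<delta> * norm (e t) * (1 + energy t)"
    using energy_deriv by metis
  \<comment> \<open>Gronwall starts at \<open>t0 + 1\<close> since the energy is known to be
    differentiable only to the right of \<open>t0\<close>.\<close>
  have "energy t \<le> (1 + energy (t0 + 1)) * exp (\<delta> * M)" if "t0 + 1 \<le> t" for t
  proof -
    have k: "continuous_on {t0..} (\<lambda>s. \<delta> * norm (e s))" by (intro continuous_intros cont_e)
    have "integral {t0..t0+1} (\<lambda>s. norm (e s)) \<ge> 0"
      by (intro integral_nonneg integrable_continuous_real continuous_intros
          continuous_on_subset[OF cont_e]) auto
    then have int_nonneg: "integral {t0..t0+1} (\<lambda>s. \<delta> * norm (e s)) \<ge> 0" using \<delta> by simp
    have int_le: "integral {t0..t} (\<lambda>s. \<delta> * norm (e s)) \<le> \<delta> * M" using \<delta> M[of t] that by simp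
    show ?thesis
      by (rule gronwall_bound[OF _ that k int_nonneg int_le, of energy D])
        (simp_all add: D energy_bounds(5))
  qed
  then show ?thesis by blast
qed

section \<open>Decay of the residual and of the objective\<close>

text \<open>The exponential form of \<open>\<beta>\<close> gives
  \<open>\<delta> \<beta>' = \<beta>\<close>, so the right side of \<open>eq_l\<close> is the exact
  derivative of \<open>(\<delta> * \<beta> t) *\<^sub>R (A (x t) - b)\<close>.\<close>

lemma dual_momentum_constant:
  "\<exists>c. \<forall>t>t0. l' t + \<alpha> *\<^sub>R l t - (\<delta> * \<beta> t) *\<^sub>R (A (x t) - b) = c"
proof -
  have "((\<lambda>t. l' t + \<alpha> *\<^sub>R l t - (\<delta> * \<beta> t) *\<^sub>R (A (x t) - b))
      has_vector_derivative 0) (at t within {t0<..})" if t: "t0 < t" for t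
  proof -
    have "((\<lambda>t. l' t + \<alpha> *\<^sub>R l t - (\<delta> * \<beta> t) *\<^sub>R (A (x t) - b)) has_vector_derivative
        l'' t + \<alpha> *\<^sub>R l' t - ((\<delta> * \<beta> t) *\<^sub>R A (x' t) + (\<delta> * (\<beta> t / \<delta>)) *\<^sub>R (A (x t) - b))) (at t)"
      by (intro has_vector_derivative_diff has_vector_derivative_add has_vector_derivative_scaleR
          bounded_linear.has_vector_derivative[OF bounded_linear_scaleR_right]
          l l' t residual_deriv DERIV_cmult \<beta>_deriv)
    moreover have "l'' t + \<alpha> *\<^sub>R l' t
        = (\<delta> * \<beta> t) *\<^sub>R A (x' t) + (\<delta> * (\<beta> t / \<delta>)) *\<^sub>R (A (x t) - b)"
      using eq_l[OF t] \<delta> by (simp add: A.add A.scaleR algebra_simps)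
    ultimately show ?thesis
      by (auto intro: has_vector_derivative_at_within)
  qed
  then obtain c where
    "\<And>t. t \<in> {t0<..} \<Longrightarrow> l' t + \<alpha> *\<^sub>R l t - (\<delta> * \<beta> t) *\<^sub>R (A (x t) - b) = c"
    by (rule has_vector_derivative_zero_constant[of "{t0<..}", rotated]) auto
  then show ?thesis by auto
qed

lemma residual_bound: "\<exists>C. \<forall>t\<ge>t0 + 1. \<beta> t * norm (A (x t) - b) \<le> C"
proof -
  obtain C where C: "\<And>t. t \<ge> t0 + 1 \<Longrightarrow> energy t \<le> C" using energy_bounded by blast
  obtain c where c: "\<And>t. t > t0 \<Longrightarrow> l' t + \<alpha> *\<^sub>R l t - (\<delta> * \<beta> t) *\<^sub>R (A (x t) - b) = c"
    using dual_momentum_constant by blast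
  \<comment> \<open>\<open>K\<close> bounds \<open>norm (l t - ls)\<close>; this uses the strict
    inequality \<open>\<alpha> * \<delta> > 1\<close>.\<close>
  define K where "K = sqrt (2 * C / (\<alpha> * \<delta> - 1))"
  have "\<beta> t * norm (A (x t) - b)
      \<le> ((sqrt (2 * C) + K) / \<delta> + \<alpha> * (norm ls + K) + norm c) / \<delta>"
    if t: "t \<ge> t0 + 1" for t
  proof -
    have "norm (l t - ls) \<le> K"
      unfolding K_def using energy_bounds(4)[of t] C[OF t] \<alpha>\<delta>
      by (intro real_le_rsqrt) (simp add: field_simps)
    then have nl: "norm (l t) \<le> norm ls + K" using norm_triangle_sub[of "l t" ls] by linarith
    have "norm (l t - ls + \<delta> *\<^sub>R l' t) \<le> sqrt (2 * C)"
      using energy_bounds(3)[of t] C[OF t] by (intro real_le_rsqrt) simp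
    \<comment> \<open>The velocity is the difference of two bounded vectors.\<close>
    then have "norm (\<delta> *\<^sub>R l' t) \<le> sqrt (2 * C) + K"
      using norm_triangle_ineq4[of "l t - ls + \<delta> *\<^sub>R l' t" "l t - ls"] \<open>norm (l t - ls) \<le> K\<close>
      by simp
    then have nl': "norm (l' t) \<le> (sqrt (2 * C) + K) / \<delta>" using \<delta> by (simp add: field_simps)
    have "\<delta> * (\<beta> t * norm (A (x t) - b)) = norm (l' t + \<alpha> *\<^sub>R l t - c)"
      using c[of t, symmetric] t \<delta> \<beta>_pos[of t] by (simp add: abs_mult)
    also have "\<dots> \<le> norm (l' t) + norm (\<alpha> *\<^sub>R l t) + norm c"
      by (meson add_mono norm_triangle_ineq norm_triangle_ineq4 order_refl order_trans)
    also have "\<dots> \<le> (sqrt (2 * C) + K) / \<delta> + \<alpha> * (norm ls + K) + norm c"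
      using nl nl' \<alpha> by (intro add_mono) auto
    finally show ?thesis using \<delta> by (simp add: field_simps)
  qed
  then show ?thesis by blast
qed

lemma objective_bound: "\<exists>C. \<forall>t\<ge>t0 + 1. \<beta> t * \<bar>f (x t) - f xs\<bar> \<le> C"
proof -
  obtain C where C: "\<And>t. t \<ge> t0 + 1 \<Longrightarrow> energy t \<le> C" using energy_bounded by blast
  obtain R where R: "\<And>t. t \<ge> t0 + 1 \<Longrightarrow> \<beta> t * norm (A (x t) - b) \<le> R"
    using residual_bound by blast
  have "\<beta> t * \<bar>f (x t) - f xs\<bar> \<le> C / \<delta>\<^sup>2 + norm ls * R" if t: "t \<ge> t0 + 1" for t
  proof -
    have "\<bar>ls \<bullet> (A (x t) - b)\<bar> \<le> norm ls * norm (A (x t) - b)" by (rule Cauchy_Schwarz_ineq2)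
    moreover have "\<sigma> / 2 * ((A (x t) - b) \<bullet> (A (x t) - b)) \<ge> 0" using \<sigma> by simp
    \<comment> \<open>Above, the nonnegative penalty is dropped from \<open>gap\<close>; below, the
      saddle inequality suffices.\<close>
    ultimately have "\<bar>f (x t) - f xs\<bar> \<le> gap t + norm ls * norm (A (x t) - b)"
      using saddle[of "x t"] gap_nonneg[of t] by (simp add: gap_def)
    then have "\<beta> t * \<bar>f (x t) - f xs\<bar> \<le> \<beta> t * (gap t + norm ls * norm (A (x t) - b))"
      using \<beta>_pos[of t] by (intro mult_left_mono) auto
    also have "\<dots> = \<beta> t * gap t + norm ls * (\<beta> t * norm (A (x t) - b))"
      by (simp add: algebra_simps)
    also have "\<dots> \<le> C / \<delta>\<^sup>2 + norm ls * R"
      using energy_bounds(1)[of t] C[OF t] R[OF t] \<delta>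
      by (intro add_mono mult_left_mono) (auto simp: field_simps)
    finally show ?thesis .
  qed
  then show ?thesis by blast
qed

lemma bigo_exp_if:
  assumes "\<exists>C. \<forall>t\<ge>t0 + 1. \<beta> t * g t \<le> C" "\<And>t. g t \<ge> 0"
  shows "g \<in> O(\<lambda>t. 1 / exp (t / \<delta>))"
proof -
  obtain C where C: "\<And>t. t \<ge> t0 + 1 \<Longrightarrow> \<beta> t * g t \<le> C" using assms(1) by blast
  have "eventually (\<lambda>t. norm (g t) \<le> (C / \<mu>) * norm (1 / exp (t / \<delta>))) at_top"
    using eventually_ge_at_top[of "t0 + 1"]
  proof eventually_elim
    case (elim t)
    then show ?case
      using C[of t] assms(2)[of t] \<mu> by (simp add: \<beta>_def field_simps)
  qed
  then show ?thesis by (rule bigoI)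
qed

lemma convergence_rates:
  "(\<lambda>t. \<bar>f (x t) - f xs\<bar>) \<in> O(\<lambda>t. 1 / exp (t / \<delta>))"
  "(\<lambda>t. norm (A (x t) - b)) \<in> O(\<lambda>t. 1 / exp (t / \<delta>))"
  by (rule bigo_exp_if[OF objective_bound] bigo_exp_if[OF residual_bound], simp)+

end

section \<open>From a global solution to the trajectory setting\<close>

lemma C2_from_has_vector_derivative:
  assumes "C2_from t0 x x' x''" "t > t0"
  shows "(x has_vector_derivative x' t) (at t)" "(x' has_vector_derivative x'' t) (at t)"
proof -
  have "at t within {t0..} = at t"
    using assms(2) by (intro at_within_interior) simp
  then show "(x has_vector_derivative x' t) (at t)" "(x' has_vector_derivative x'' t) (at t)"
    using assms unfolding C2_from_def by (metis less_imp_le)+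
qed

lemma C2_from_continuous_on:
  assumes "C2_from t0 x x' x''"
  shows "continuous_on {t0..} x" "continuous_on {t0..} x'" "continuous_on {t0..} x''"
  using assms unfolding C2_from_def
  by (auto simp: continuous_on_eq_continuous_within intro: has_vector_derivative_continuous)

text \<open>Moving the multiplier by the residual \<open>A xs - b\<close> itself would raise the
  Lagrangian by the squared norm of the residual, which must therefore be zero.\<close>

lemma saddle_points_feasible:
  assumes "(xs, ls) \<in> saddle_points f A b"
  shows "A xs = b" "f xs \<le> f u + ls \<bullet> (A u - b)"
proof -
  have L: "lagrangian f A b xs l \<le> lagrangian f A b xs ls"
    "lagrangian f A b xs ls \<le> lagrangian f A b u ls" for l u
    using assms by (auto simp: saddle_points_def)
  have "(A xs - b) \<bullet> (A xs - b) \<le> 0"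
    using L(1)[of "ls + (A xs - b)"] by (simp add: lagrangian_def inner_add_left)
  then show "A xs = b" by (metis eq_iff_diff_eq_0 inner_eq_zero_iff inner_ge_zero order_antisym)
  then show "f xs \<le> f u + ls \<bullet> (A u - b)" using L(2)[of u] by (simp add: lagrangian_def)
qed

theorem theorem2p2:
  fixes f :: "'a::{real_inner,banach} \<Rightarrow> real"
    and A :: "'a \<Rightarrow> 'b::{real_inner,banach}"
    and b :: 'b
    and t0 \<alpha> \<delta> \<sigma> \<mu> :: real
    and \<beta> :: "real \<Rightarrow> real"
    and \<epsilon> :: "real \<Rightarrow> 'a"
    and x :: "real \<Rightarrow> 'a"
    and l :: "real \<Rightarrow> 'b"
    and xs :: 'a
    and ls :: 'b
  assumes "bounded_linear A"
    and "convex_on UNIV f"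
    and "continuously_differentiable f"
    and "t0 > 0" and "\<alpha> > 0" and "\<delta> > 0" and "\<alpha> * \<delta> > 1" and "\<sigma> \<ge> 0" and "\<mu> > 0"
    and "\<And>t. t \<ge> t0 \<Longrightarrow> \<beta> t = \<mu> * exp (t / \<delta>)"
    and "set_integrable lebesgue {t0..} (\<lambda>t. norm (\<epsilon> t))"
    and "global_solution f A b t0 \<alpha> \<delta> \<sigma> \<beta> \<epsilon> x l"
    and "(xs, ls) \<in> saddle_points f A b"
  shows "(\<lambda>t. \<bar>f (x t) - f xs\<bar>) \<in> O(\<lambda>t. 1 / exp (t / \<delta>)) \<and>
         (\<lambda>t. norm (A (x t) - b)) \<in> O(\<lambda>t. 1 / exp (t / \<delta>))"
proof -
  note linA = \<open>bounded_linear A\<close>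
  interpret A: bounded_linear A by (rule linA)
  interpret At: bounded_linear "adjoint A" by (rule bounded_linear_adjoint[OF linA])
  obtain x' x'' l' l'' where cx: "C2_from t0 x x' x''" and cl: "C2_from t0 l l' l''"
    and ae: "AE t in lebesgue. t \<ge> t0 \<longrightarrow>
        x'' t + \<alpha> *\<^sub>R x' t =
          - (\<beta> t *\<^sub>R (gradient f (x t) + adjoint A (l t + \<delta> *\<^sub>R l' t)
                      + \<sigma> *\<^sub>R adjoint A (A (x t) - b))) + \<epsilon> t \<and>
        l'' t + \<alpha> *\<^sub>R l' t = \<beta> t *\<^sub>R (A (x t + \<delta> *\<^sub>R x' t) - b)"
    using \<open>global_solution f A b t0 \<alpha> \<delta> \<sigma> \<beta> \<epsilon> x l\<close> unfolding global_solution_def by blast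
  have \<beta>: "\<beta> t = \<mu> * exp (t / \<delta>)" if "t \<ge> t0" for t using that by fact
  have cont_\<beta>: "continuous_on {t0..} \<beta>"
    by (subst continuous_on_cong[OF refl, where g = "\<lambda>t. \<mu> * exp (t / \<delta>)"])
      (use \<open>\<delta> > 0\<close> in \<open>auto simp: \<beta> intro!: continuous_intros\<close>)
  note cont = C2_from_continuous_on[OF cx] C2_from_continuous_on[OF cl] cont_\<beta>
  have cont_grad: "continuous_on {t0..} (\<lambda>t. gradient f (x t))"
    using \<open>continuously_differentiable f\<close> cont(1)
    by (auto simp: continuously_differentiable_def intro: continuous_on_compose2)
  txt \<open>The perturbation agrees almost everywhere with a continuous function, by which it can be
    replaced; the equations then hold at every \<open>t > t0\<close>.\<close>
  define e where "e t = x'' t + \<alpha> *\<^sub>R x' t + \<beta> t *\<^sub>R (gradient f (x t)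
      + adjoint A (l t + \<delta> *\<^sub>R l' t) + \<sigma> *\<^sub>R adjoint A (A (x t) - b))" for t
  have cont_e: "continuous_on {t0..} e"
    unfolding e_def by (intro continuous_intros At.continuous_on A.continuous_on cont cont_grad)
  have "AE t in lebesgue. t \<ge> t0 \<longrightarrow> norm (e t) = norm (\<epsilon> t)"
    using ae by eventually_elim (auto simp: e_def)
  then have int_e: "integral {t0..t} (\<lambda>s. norm (e s)) \<le> integral {t0..} (\<lambda>s. norm (\<epsilon> s))" for t
    using \<open>set_integrable lebesgue {t0..} (\<lambda>t. norm (\<epsilon> t))\<close>
    by (intro integral_le_AE_eq continuous_intros cont_e) auto
  have eq_l: "l'' t + \<alpha> *\<^sub>R l' t - \<beta> t *\<^sub>R (A (x t + \<delta> *\<^sub>R x' t) - b) = 0" if "t > t0" for t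
  proof (rule continuous_AE_eq_0[OF _ _ that])
    show "continuous_on {t0..} (\<lambda>t. l'' t + \<alpha> *\<^sub>R l' t - \<beta> t *\<^sub>R (A (x t + \<delta> *\<^sub>R x' t) - b))"
      by (intro continuous_intros A.continuous_on cont)
    show "AE t in lebesgue. t \<ge> t0 \<longrightarrow>
        l'' t + \<alpha> *\<^sub>R l' t - \<beta> t *\<^sub>R (A (x t + \<delta> *\<^sub>R x' t) - b) = 0"
      using ae by eventually_elim auto
  qed
  interpret primal_dual_trajectory f "gradient f" A "adjoint A" b xs ls x x' x'' e l l' l''
    t0 \<alpha> \<delta> \<sigma> \<mu> "\<lambda>t. \<mu> * exp (t / \<delta>)"
  proof unfold_locales
    show "GDERIV f u :> gradient f u" for u
      using \<open>continuously_differentiable f\<close>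
      by (auto simp: continuously_differentiable_def intro: GDERIV_gradient)
    show "\<exists>M. \<forall>t\<ge>t0. integral {t0..t} (\<lambda>s. norm (e s)) \<le> M" using int_e by blast
    show "x'' t + \<alpha> *\<^sub>R x' t = - ((\<mu> * exp (t / \<delta>)) *\<^sub>R (gradient f (x t)
        + adjoint A (l t + \<delta> *\<^sub>R l' t) + \<sigma> *\<^sub>R adjoint A (A (x t) - b))) + e t" if "t > t0" for t
      using that by (simp add: e_def \<beta>)
    show "l'' t + \<alpha> *\<^sub>R l' t = (\<mu> * exp (t / \<delta>)) *\<^sub>R (A (x t + \<delta> *\<^sub>R x' t) - b)" if "t > t0" for t
      using eq_l[OF that] that by (simp add: \<beta>)
  qed (use assms adjoint_inner[OF linA] cont_e saddle_points_feasible
      C2_from_has_vector_derivative[OF cx] C2_from_has_vector_derivative[OF cl] in blast)+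
  show ?thesis using convergence_rates by blast
qed

end
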